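(* Step 2 of the implementable version of tPLDCA terminates within finitely many inner iterations. That is, at every iteration $k\in\mathbb{N}$ (with current iterate $x_k$, vector $u_k$ found in Step 1, and inner iterates $z_{-1}=x_k$ and $(z_i)_{i\in\mathbb{N}}$ generated by $T_g(x_k,u_k,\lambda)$), there exists $N_k\in\{-1\}\cup\mathbb{N}$ such that $z_{N_k}$ satisfies simultaneously $$g(x_k)-g(z_{N_k})-\langle u_k,x_k-z_{N_k}\rangle\ \ge\ \frac{1-\sigma}{\lambda}\|z_{N_k}-x_k\|^2$$ and $$\mathrm{dist}\left(u_k,\hat\partial_{\zeta_k}g(z_{N_k})\right)\ \le\ \theta\|z_{N_k}-x_k\|.$$
   Context: Notation: $\mathbb{N}=\{0,1,2,\dots\}$; $\langle\cdot,\cdot\rangle$ and $\|\cdot\|$ are the inner product and Euclidean norm on $\mathbb{R}^n$. $\Gamma_0(\mathbb{R}^n)$ is the set of proper, lower semicontinuous, convex functions $\mathbb{R}^n\to\mathbb{R}\cup\{+\infty\}$; $\mathrm{dom}\,\phi=\{x:\phi(x)<+\infty\}$. For $\phi\in\Gamma_0(\mathbb{R}^n)$, $x\in\mathrm{dom}\,\phi$, $\epsilon>0$: $\partial\phi(x)=\{s:\phi(y)\ge\phi(x)+\langle s,y-x\rangle\ \forall y\in\mathbb{R}^n\}$ and $\partial_\epsilon\phi(x)=\{s:\phi(y)\ge\phi(x)+\langle s,y-x\rangle-\epsilon\ \forall y\in\mathbb{R}^n\}$; for $\epsilon=0$, $\partial_0\phi=\partial\phi$. For a nonempty closed set $S$,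 $\mathrm{dist}(x,S)=\min_{y\in S}\|x-y\|$. Standing assumptions: $g,h\in\Gamma_0(\mathbb{R}^n)$, $f=g-h$, and (1) $\inf_{x\in\mathbb{R}^n} f(x)>-\infty$; (2) $\mathrm{dom}\,h=\mathbb{R}^n$; (3) $g(x)=\max\{g_1(x),\dots,g_p(x)\}$ for all $x\in\mathbb{R}^n$, where $p\ge1$ and $g_1,\dots,g_p:\mathbb{R}^n\to\mathbb{R}$ are smooth (continuously differentiable) convex functions (so $\mathrm{dom}\,g=\mathbb{R}^n$); (4) there is an inner iterative algorithm $T_g$ such that for any $(x_k,u_k,\lambda_k)\in\mathrm{dom}\,g\times\mathbb{R}^n\times(0,\infty)$, $T_g(x_k,u_k,\lambda_k)$ generates a sequence $(z_i)_{i\in\mathbb{N}}$ in $\mathrm{dom}\,g$ converging to a solution $\bar z_k$ of the proximal point subproblem (PP): minimize over $z\in\mathbb{R}^n$ the function $\tilde f_k(z)=g(z)-\langle u_k,z-x_k\rangle+\frac{1}{2\lambda_k}\|z-x_k\|^2$; i.e. $0\in\partial\tilde f_k(\bar z_k)=\partial g(\bar z_k)-u_k+\frac{1}{\lambda_k}(\bar z_k-x_k)$. $\epsilon$-strict subdifferential: for $x\in\mathbb{R}^n$, $\epsilon\ge0$, $\hat\partial_\epsilon g(x)=\mathrm{Conv}\{\nabla g_i(x): i\in I_{g,\epsilon}(x)\}$ (convex hull), where $I_{g,\epsilon}(x)=\{i\in\{1,\dots,p\}: g_i(x)\ge g(x)-\epsilon\}$. Implementable version of tPLDCA (Algorithm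 3 of the paper). Parameters: $\sigma\in(0,1)$, $\lambda>0$, $\theta>\frac1\lambda$, $\rho\in[0,\frac{1-\sigma}{\lambda})$, $\gamma\in[0,\frac{1-\sigma}{\lambda}-\rho)$, $\lambda_k=\lambda$ for all $k\in\mathbb{N}$, and positive numbers $(\zeta_k)_{k\in\mathbb{N}}$ with $\zeta_k\to0$. Start with $x_{-1},x_0\in\mathrm{dom}\,f=\{x:f(x)<+\infty\}$ and for $k=0,1,2,\dots$ do: Step 1: find $u_k\in\mathbb{R}^n$ with $\mathrm{dist}(u_k,\partial_{\epsilon_k}h(x_k))\le d_k$, where $\epsilon_k=\rho\|x_k-x_{k-1}\|^2$ and $d_k=\gamma\|x_k-x_{k-1}\|$. Step 2: set $z_{-1}=x_k$ and generate $z_0,z_1,\dots$ by $T_g(x_k,u_k,\lambda_k)$ until, for some $i\in\{-1\}\cup\mathbb{N}$, both $g(x_k)-g(z_i)-\langle u_k,x_k-z_i\rangle\ge\frac{1-\sigma}{\lambda}\|z_i-x_k\|^2$ and $\mathrm{dist}(u_k,\hat\partial_{\zeta_k}g(z_i))\le\theta\|z_i-x_k\|$ hold; then set $x_{k+1}=z_i$. *)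

theory Defs
  imports "HOL-Analysis.Analysis"
begin

definition effective_domain :: "('a \<Rightarrow> ereal) \<Rightarrow> 'a set" where
  "effective_domain \<phi> = {x. \<phi> x < \<infinity>}"

definition proper_fun :: "('a \<Rightarrow> ereal) \<Rightarrow> bool" where
  "proper_fun \<phi> \<longleftrightarrow> (\<forall>x. \<phi> x \<noteq> -\<infinity>) \<and> effective_domain \<phi> \<noteq> {}"

definition lower_semicontinuous :: "('a::topological_space \<Rightarrow> ereal) \<Rightarrow> bool" where
  "lower_semicontinuous \<phi> \<longleftrightarrow> (\<forall>x. \<phi> x \<le> Liminf (nhds x) \<phi>)"

(* Convexity of the epigraph: the usual inequality, stated so that no sum of
   infinite values occurs. The library constant epigraph covers only real-valued functions. *)
definition convex_ereal_fun :: "('a::real_vector \<Rightarrow> ereal) \<Rightarrow> bool" where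
  "convex_ereal_fun \<phi> \<longleftrightarrow> convex {(x, r::real). \<phi> x \<le> ereal r}"

definition Gamma0 :: "('a::euclidean_space \<Rightarrow> ereal) set" where
  "Gamma0 = {\<phi>. proper_fun \<phi> \<and> lower_semicontinuous \<phi> \<and> convex_ereal_fun \<phi>}"

(* Intended for x in the effective domain and e \<ge> 0; e = 0 gives the convex subdifferential. *)
definition eps_subdifferential :: "('a::real_inner \<Rightarrow> ereal) \<Rightarrow> real \<Rightarrow> 'a \<Rightarrow> 'a set" where
  "eps_subdifferential \<phi> e x = {s. \<forall>y. \<phi> y \<ge> \<phi> x + ereal (s \<bullet> (y - x)) - ereal e}"

definition continuously_differentiable :: "('a::real_inner \<Rightarrow> real) \<Rightarrow> bool" where
  "continuously_differentiable \<phi> \<longleftrightarrow>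
     (\<exists>\<phi>'. (\<forall>x. GDERIV \<phi> x :> \<phi>' x) \<and> continuous_on UNIV \<phi>')"

definition gradient :: "('a::real_inner \<Rightarrow> real) \<Rightarrow> 'a \<Rightarrow> 'a" where
  "gradient \<phi> x = (THE D. GDERIV \<phi> x :> D)"

(* For g = max(gs 1, ..., gs p). *)
definition strict_active ::
  "('a \<Rightarrow> ereal) \<Rightarrow> (nat \<Rightarrow> 'a \<Rightarrow> real) \<Rightarrow> nat \<Rightarrow> real \<Rightarrow> 'a \<Rightarrow> nat set" where
  "strict_active g gs p e x = {i \<in> {1..p}. ereal (gs i x) \<ge> g x - ereal e}"

definition strict_subdifferential ::
  "('a::real_inner \<Rightarrow> ereal) \<Rightarrow> (nat \<Rightarrow> 'a \<Rightarrow> real) \<Rightarrow> nat \<Rightarrow> real \<Rightarrow> 'a \<Rightarrow> 'a set" where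
  "strict_subdifferential g gs p e x =
     convex hull ((\<lambda>i. gradient (gs i) x) ` strict_active g gs p e x)"

definition prox_objective ::
  "('a::real_inner \<Rightarrow> ereal) \<Rightarrow> 'a \<Rightarrow> 'a \<Rightarrow> real \<Rightarrow> 'a \<Rightarrow> ereal" where
  "prox_objective g x u lam z =
     g z - ereal (u \<bullet> (z - x)) + ereal (1 / (2 * lam) * (norm (z - x))\<^sup>2)"

(* T x u lam is the sequence of inner iterates indexed from 0. *)
definition inner_algorithm ::
  "('a::real_inner \<Rightarrow> ereal) \<Rightarrow> ('a \<Rightarrow> 'a \<Rightarrow> real \<Rightarrow> nat \<Rightarrow> 'a) \<Rightarrow> bool" where
  "inner_algorithm g T \<longleftrightarrow>
     (\<forall>x \<in> effective_domain g. \<forall>u. \<forall>lam > 0.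
        (\<forall>i. T x u lam i \<in> effective_domain g) \<and>
        (\<exists>zbar. is_arg_min (prox_objective g x u lam) (\<lambda>z. True) zbar \<and>
                T x u lam \<longlonglongrightarrow> zbar))"

(* Inner iterates indexed by {-1, 0, 1, ...}, with index -1 the current outer iterate;
   indices below -1 are never used. *)
definition inner_iterate ::
  "('a \<Rightarrow> 'a \<Rightarrow> real \<Rightarrow> nat \<Rightarrow> 'a) \<Rightarrow> 'a \<Rightarrow> 'a \<Rightarrow> real \<Rightarrow> int \<Rightarrow> 'a" where
  "inner_iterate T x u lam i = (if i = -1 then x else T x u lam (nat i))"

(* infdist agrees with the minimal distance for nonempty closed sets (it would be 0 for the
   empty set); an eps-subdifferential of a finite convex function, and a strict
   subdifferential with e > 0 of a maximum of p \<ge> 1 functions, are nonempty and closed. *)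
definition tPLDCA_step1 ::
  "('a::real_inner \<Rightarrow> ereal) \<Rightarrow> real \<Rightarrow> real \<Rightarrow> 'a \<Rightarrow> 'a \<Rightarrow> 'a \<Rightarrow> bool" where
  "tPLDCA_step1 h \<rho> \<gamma> xprev x u \<longleftrightarrow>
     infdist u (eps_subdifferential h (\<rho> * (norm (x - xprev))\<^sup>2) x) \<le> \<gamma> * norm (x - xprev)"

definition tPLDCA_stop ::
  "('a::real_inner \<Rightarrow> ereal) \<Rightarrow> (nat \<Rightarrow> 'a \<Rightarrow> real) \<Rightarrow> nat \<Rightarrow> real \<Rightarrow> real \<Rightarrow> real \<Rightarrow> real
     \<Rightarrow> 'a \<Rightarrow> 'a \<Rightarrow> 'a \<Rightarrow> bool" where
  "tPLDCA_stop g gs p \<sigma> lam \<theta> z_tol x u z \<longleftrightarrow>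
     g x - g z - ereal (u \<bullet> (x - z)) \<ge> ereal ((1 - \<sigma>) / lam * (norm (z - x))\<^sup>2) \<and>
     infdist u (strict_subdifferential g gs p z_tol z) \<le> \<theta> * norm (z - x)"

(* The outer iterations 0, ..., K - 1 have been completed and have produced
   x (-1), x 0, ..., x K and u 0, ..., u (K - 1); later values are unconstrained. *)
definition tPLDCA_run ::
  "('a::real_inner \<Rightarrow> ereal) \<Rightarrow> ('a \<Rightarrow> ereal) \<Rightarrow> (nat \<Rightarrow> 'a \<Rightarrow> real) \<Rightarrow> nat
     \<Rightarrow> ('a \<Rightarrow> 'a \<Rightarrow> real \<Rightarrow> nat \<Rightarrow> 'a)
     \<Rightarrow> real \<Rightarrow> real \<Rightarrow> real \<Rightarrow> real \<Rightarrow> real \<Rightarrow> (nat \<Rightarrow> real)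
     \<Rightarrow> (int \<Rightarrow> 'a) \<Rightarrow> (nat \<Rightarrow> 'a) \<Rightarrow> nat \<Rightarrow> bool" where
  "tPLDCA_run g h gs p T \<sigma> lam \<theta> \<rho> \<gamma> \<zeta> x u K \<longleftrightarrow>
     x (-1) \<in> effective_domain (\<lambda>y. g y - h y) \<and>
     x 0 \<in> effective_domain (\<lambda>y. g y - h y) \<and>
     (\<forall>k<K.
        tPLDCA_step1 h \<rho> \<gamma> (x (int k - 1)) (x (int k)) (u k) \<and>
        (\<exists>i \<ge> -1.
           tPLDCA_stop g gs p \<sigma> lam \<theta> (\<zeta> k) (x (int k)) (u k)
             (inner_iterate T (x (int k)) (u k) lam i) \<and>
           (\<forall>j. -1 \<le> j \<and> j < i \<longrightarrow>
              \<not> tPLDCA_stop g gs p \<sigma> lam \<theta> (\<zeta> k) (x (int k)) (u k)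
                  (inner_iterate T (x (int k)) (u k) lam j)) \<and>
           x (int k + 1) = inner_iterate T (x (int k)) (u k) lam i))"

end

theory Submission
  imports Defs
begin

text \<open>Let z be the limit of the inner iterates. Fermat's rule for the proximal objective, a maximum
  of smooth functions, puts u - (z - x) / lam in the convex hull of the active gradients at z. If
  z = x, then u itself lies there and the index -1 works. Otherwise strong convexity makes the
  descent condition strict at z, and u has distance at most |z - x| / lam < theta |z - x| to that hull.
  Both strict inequalities survive for inner iterates close to z, because indices active at z are
  eventually nearly active and the gradients are continuous.\<close>

lemma gradient_eq:
  assumes "GDERIV \<phi> x :> D"
  shows "gradient \<phi> x = D"
  unfolding gradient_def
proof (rule the_equality[where P = "\<lambda>D. GDERIV \<phi> x :> D", OF assms])
  fix D' assume "GDERIV \<phi> x :> D'"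
  then have "(\<lambda>h. h \<bullet> D') = (\<lambda>h. h \<bullet> D)"
    using assms unfolding gderiv_def by (rule has_derivative_unique)
  \<comment> \<open>Evaluating both derivatives in the direction \<open>D' - D\<close> turns their
    equality into a vanishing squared norm.\<close>
  then have "(D' - D) \<bullet> D' = (D' - D) \<bullet> D" by metis
  then have "(D' - D) \<bullet> (D' - D) = 0" by (simp add: inner_diff_right)
  then show "D' = D" by simp
qed

lemma continuously_differentiable_gradient:
  assumes "continuously_differentiable \<phi>"
  shows "GDERIV \<phi> x :> gradient \<phi> x" "isCont (gradient \<phi>) x"
proof -
  obtain \<phi>' where D: "\<And>x. GDERIV \<phi> x :> \<phi>' x" and c: "continuous_on UNIV \<phi>'"
    using assms unfolding continuously_differentiable_def by blast
  then have "gradient \<phi> = \<phi>'" by (auto simp: gradient_eq)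
  then show "GDERIV \<phi> x :> gradient \<phi> x" "isCont (gradient \<phi>) x"
    using D c by (auto simp: continuous_on_eq_continuous_at)
qed

lemma convex_on_Max:
  fixes f :: "'i \<Rightarrow> 'a::real_vector \<Rightarrow> real"
  assumes "finite I" "I \<noteq> {}" "convex S" "\<And>i. i \<in> I \<Longrightarrow> convex_on S (f i)"
  shows "convex_on S (\<lambda>y. Max ((\<lambda>i. f i y) ` I))"
proof (rule convex_onI)
  fix t :: real and x y
  assume t: "0 < t" "t < 1" and xy: "x \<in> S" "y \<in> S"
  let ?m = "\<lambda>y. Max ((\<lambda>i. f i y) ` I)"
  have "f i ((1 - t) *\<^sub>R x + t *\<^sub>R y) \<le> (1 - t) * ?m x + t * ?m y" if i: "i \<in> I" for i
  proof -
    have "f i ((1 - t) *\<^sub>R x + t *\<^sub>R y) \<le> (1 - t) * f i x + t * f i y"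
      using convex_onD[OF assms(4)[OF i]] t xy by simp
    also have "\<dots> \<le> (1 - t) * ?m x + t * ?m y"
      using i t assms(1) by (intro add_mono mult_left_mono) auto
    finally show ?thesis .
  qed
  then show "?m ((1 - t) *\<^sub>R x + t *\<^sub>R y) \<le> (1 - t) * ?m x + t * ?m y"
    using assms(1,2) by (subst Max_le_iff) auto
qed fact

text \<open>If 0 were strictly separated from the active gradients, the separating direction would
  decrease all active functions at once, and the inactive ones stay below by continuity.\<close>

lemma zero_in_convex_hull_active_gradients:
  fixes f :: "'i \<Rightarrow> 'a::euclidean_space \<Rightarrow> real"
  assumes I: "finite I" "I \<noteq> {}"
    and D: "\<And>i. i \<in> I \<Longrightarrow> GDERIV (f i) z :> D i"
    and min: "\<And>y. Max ((\<lambda>i. f i z) ` I) \<le> Max ((\<lambda>i. f i y) ` I)"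
  shows "0 \<in> convex hull (D ` {i \<in> I. f i z = Max ((\<lambda>i. f i z) ` I)})"
proof (rule ccontr)
  let ?M = "Max ((\<lambda>i. f i z) ` I)"
  let ?C = "convex hull (D ` {i \<in> I. f i z = ?M})"
  assume "0 \<notin> ?C"
  moreover have "closed ?C"
    using I by (intro compact_imp_closed compact_convex_hull finite_imp_compact) auto
  \<comment> \<open>Since \<open>a\<close> has positive inner product with every active gradient,
    the descent direction is \<open>- a\<close>. The points tried below are therefore
    \<open>z - t *\<^sub>R a\<close> for small positive \<open>t\<close>.\<close>
  ultimately obtain a b where ab: "0 < b" "\<And>x. x \<in> ?C \<Longrightarrow> a \<bullet> x > b"
    using separating_hyperplane_closed_0[OF convex_convex_hull] by blast
  have "eventually (\<lambda>t. f i (z - t *\<^sub>R a) < ?M) (at_right 0)" if i: "i \<in> I" for i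
  proof (cases "f i z = ?M")
    case True
    have "D i \<in> ?C" using i True by (intro hull_inc) auto
    then have neg: "- (a \<bullet> D i) < 0" using ab by fastforce
    have "((\<lambda>t. f i (z - t *\<^sub>R a)) has_derivative (\<lambda>h. (- (h *\<^sub>R a)) \<bullet> D i)) (at 0)"
      by (rule has_derivative_compose[where f = "\<lambda>t. z - t *\<^sub>R a" and g = "f i"])
        (use D[OF i] in \<open>auto intro!: derivative_eq_intros simp: gderiv_def\<close>)
    then have "((\<lambda>t. f i (z - t *\<^sub>R a)) has_real_derivative - (a \<bullet> D i)) (at 0)"
      by (rule has_derivative_imp_has_field_derivative) simp
    from has_real_derivative_neg_dec_right[OF this neg]
    obtain d where "d > 0" "\<And>h. 0 < h \<Longrightarrow> h < d \<Longrightarrow> f i (z - h *\<^sub>R a) < f i z"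
      by auto
    then show ?thesis unfolding True[symmetric] eventually_at_right_field by auto
  next
    case False
    moreover have "f i z \<le> ?M" using I i by auto
    ultimately have lt: "f i z < ?M" by simp
    have "isCont (f i) z"
      using D[OF i] unfolding gderiv_def by (rule has_derivative_continuous)
    moreover have "((\<lambda>t. z - t *\<^sub>R a) \<longlongrightarrow> z) (at_right 0)"
      by (rule tendsto_eq_intros refl | simp)+
    ultimately have "((\<lambda>t. f i (z - t *\<^sub>R a)) \<longlongrightarrow> f i z) (at_right 0)"
      by (rule isCont_tendsto_compose)
    then show ?thesis using lt by (rule order_tendstoD)
  qed
  then have "eventually (\<lambda>t. \<forall>i\<in>I. f i (z - t *\<^sub>R a) < ?M) (at_right 0)"
    using I by (simp add: eventually_ball_finite_distrib)
  then obtain t where "\<forall>i\<in>I. f i (z - t *\<^sub>R a) < ?M"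
    by (rule eventually_happens'[OF trivial_limit_at_right_real, THEN exE])
  then have "Max ((\<lambda>i. f i (z - t *\<^sub>R a)) ` I) < ?M"
    using I by (subst Max_less_iff) auto
  then show False using min[of "z - t *\<^sub>R a"] by simp
qed

text \<open>The linear and quadratic terms do not depend on the index, so they can be moved inside
  the maximum. This keeps the active indices and translates all gradients by one vector, so Fermat's
  rule for a maximum applies and the hull is translated back.\<close>

lemma prox_gradient_in_convex_hull:
  fixes f :: "'i \<Rightarrow> 'a::euclidean_space \<Rightarrow> real"
  assumes I: "finite I" "I \<noteq> {}"
    and D: "\<And>i. i \<in> I \<Longrightarrow> GDERIV (f i) z :> D i"
    and G: "\<And>y. G y = Max ((\<lambda>i. f i y) ` I)"
    and min: "\<And>y. G z - u \<bullet> (z - x) + 1 / (2 * lam) * (norm (z - x))\<^sup>2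
                \<le> G y - u \<bullet> (y - x) + 1 / (2 * lam) * (norm (y - x))\<^sup>2"
  shows "u - (1 / lam) *\<^sub>R (z - x) \<in> convex hull (D ` {i \<in> I. f i z = G z})"
proof -
  define c where "c = 1 / (2 * lam)"
  have c: "1 / lam = 2 * c" by (simp add: c_def)
  define q where "q y = c * ((y - x) \<bullet> (y - x)) - u \<bullet> (y - x)" for y
  define v where "v = u - (1 / lam) *\<^sub>R (z - x)"
  \<comment> \<open>\<open>v\<close> is chosen as the negative gradient of the index-free part
    \<open>q\<close>, so 0 in the hull of the translated gradients means \<open>v\<close> in the
    original hull.\<close>
  have q': "GDERIV q z :> - v"
    unfolding gderiv_def q_def v_def c
    by (rule derivative_eq_intros refl)+
      (simp add: inner_diff_right inner_commute algebra_simps)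
  have Mq: "Max ((\<lambda>i. f i y + q y) ` I) = G y + q y" for y
    using Max_add_commute[OF I] by (simp add: G)
  have "0 \<in> convex hull ((\<lambda>i. D i + - v) ` {i \<in> I. f i z + q z = Max ((\<lambda>i. f i z + q z) ` I)})"
  proof (rule zero_in_convex_hull_active_gradients[OF I])
    show "GDERIV (\<lambda>y. f i y + q y) z :> D i + - v" if "i \<in> I" for i
      by (rule GDERIV_add[OF D[OF that] q'])
    show "Max ((\<lambda>i. f i z + q z) ` I) \<le> Max ((\<lambda>i. f i y + q y) ` I)" for y
      using min[of y] unfolding Mq by (simp add: q_def c_def power2_norm_eq_inner)
  qed
  also have "(\<lambda>i. D i + - v) ` {i \<in> I. f i z + q z = Max ((\<lambda>i. f i z + q z) ` I)}
      = (\<lambda>y. - v + y) ` D ` {i \<in> I. f i z = G z}"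
    unfolding Mq by (auto simp: image_image)
  also have "convex hull \<dots> = (\<lambda>y. - v + y) ` (convex hull (D ` {i \<in> I. f i z = G z}))"
    by (rule convex_hull_translation)
  finally obtain y where "y \<in> convex hull (D ` {i \<in> I. f i z = G z})" "0 = - v + y"
    by blast
  then show ?thesis by (simp add: v_def[symmetric] add_eq_0_iff)
qed

text \<open>Compares the minimizer with its convex combination with x at parameter t; letting t tend
  to 0 would give the sharp constant 1 / lam.\<close>

lemma prox_descent:
  fixes G :: "'a::real_inner \<Rightarrow> real"
  assumes G: "convex_on UNIV G" and t: "0 < t" "t \<le> 1"
    and min: "\<And>y. G z - u \<bullet> (z - x) + 1 / (2 * lam) * (norm (z - x))\<^sup>2
                \<le> G y - u \<bullet> (y - x) + 1 / (2 * lam) * (norm (y - x))\<^sup>2"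
  shows "(1 - t / 2) / lam * (norm (z - x))\<^sup>2 \<le> G x - G z - u \<bullet> (x - z)"
proof -
  define y where "y = (1 - t) *\<^sub>R z + t *\<^sub>R x"
  have yx: "y - x = (1 - t) *\<^sub>R (z - x)" by (simp add: y_def algebra_simps)
  have "G y \<le> (1 - t) * G z + t * G x"
    unfolding y_def using convex_onD[OF G, of t z x] t by simp
  moreover have "u \<bullet> (y - x) = (1 - t) * (u \<bullet> (z - x))" by (simp add: yx)
  moreover have "(norm (y - x))\<^sup>2 = (1 - t)\<^sup>2 * (norm (z - x))\<^sup>2"
    by (simp add: yx power_mult_distrib)
  moreover define c where "c = 1 / (2 * lam)"
  ultimately have "G z - u \<bullet> (z - x) + c * (norm (z - x))\<^sup>2
      \<le> (1 - t) * G z + t * G x - (1 - t) * (u \<bullet> (z - x)) + c * ((1 - t)\<^sup>2 * (norm (z - x))\<^sup>2)"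
    using min[of y] by simp
  \<comment> \<open>The quadratic terms combine through 1 - (1 - t)^2 = t (2 - t), so both sides
    carry a factor \<open>t\<close>, cancelled at the end because \<open>t\<close> is
    positive.\<close>
  then have "t * ((2 - t) * c * (norm (z - x))\<^sup>2) \<le> t * (G x - G z + u \<bullet> (z - x))"
    by (simp add: algebra_simps power2_eq_square)
  moreover have "(1 - t / 2) / lam = (2 - t) * c" "u \<bullet> (x - z) = - (u \<bullet> (z - x))"
    by (simp_all add: c_def inner_diff_right diff_divide_distrib)
  ultimately show ?thesis using t by simp
qed

text \<open>The weights are attached to indices instead of points, so that they can be reused when
  the gradients are taken at another point.\<close>

lemma convex_hull_image_weights:
  fixes f :: "'i \<Rightarrow> 'a::real_vector"
  assumes "finite A" "v \<in> convex hull (f ` A)"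
  obtains B w where "B \<subseteq> A" "\<And>i. i \<in> B \<Longrightarrow> 0 \<le> w i" "sum w B = (1::real)"
    "(\<Sum>i\<in>B. w i *\<^sub>R f i) = v"
proof -
  \<comment> \<open>Several indices may have the same image. Keeping one index per image lets the
    weights on points be pulled back along \<open>f\<close>.\<close>
  obtain B where B: "B \<subseteq> A" "inj_on f B" "f ` A = f ` B"
    by (metis subset_image_inj order_refl)
  then have "finite (f ` B)" using assms(1) by (simp add: finite_subset)
  then obtain w where "\<forall>y\<in>f ` B. 0 \<le> w y" "sum w (f ` B) = (1::real)" "(\<Sum>y\<in>f ` B. w y *\<^sub>R y) = v"
    using assms(2) unfolding B(3) by (auto simp: convex_hull_finite)
  then show thesis using that[of B "w \<circ> f"] B by (simp add: sum.reindex)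
qed

text \<open>The weights representing \<open>v\<close> at \<open>z\<close> are frozen and applied to
  the gradients at \<open>s n\<close>. These combinations tend to \<open>v\<close>, and they
  eventually lie in the strict subdifferential because the tolerance \<open>e\<close> is positive.
  The bound \<open>r n\<close> varies because the right-hand side of the stopping test moves with
  the iterate.\<close>

lemma eventually_infdist_strict_subdifferential_less:
  fixes gs :: "nat \<Rightarrow> 'a::euclidean_space \<Rightarrow> real"
  assumes gs: "\<And>i. i \<in> {1..p} \<Longrightarrow> continuously_differentiable (gs i)"
    and g: "\<And>y. g y = ereal (G y)" and G: "isCont G z" and e: "e > 0"
    and s: "s \<longlonglongrightarrow> z"
    and v: "v \<in> convex hull ((\<lambda>i. gradient (gs i) z) ` {i \<in> {1..p}. gs i z = G z})"
    and r: "r \<longlonglongrightarrow> r0" "norm (u - v) < r0"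
  shows "eventually (\<lambda>n. infdist u (strict_subdifferential g gs p e (s n)) < r n) sequentially"
proof -
  let ?A = "{i \<in> {1..p}. gs i z = G z}"
  obtain B w where B: "B \<subseteq> ?A" and w: "\<And>i. i \<in> B \<Longrightarrow> 0 \<le> w i" "sum w B = 1"
      "(\<Sum>i\<in>B. w i *\<^sub>R gradient (gs i) z) = v"
    by (rule convex_hull_image_weights[OF _ v]) auto
  have fin: "finite B" using B by (rule finite_subset) simp
  define V where "V n = (\<Sum>i\<in>B. w i *\<^sub>R gradient (gs i) (s n))" for n
  have "V \<longlonglongrightarrow> v"
    unfolding V_def w(3)[symmetric]
    using B by (intro tendsto_intros isCont_tendsto_compose[OF _ s] continuously_differentiable_gradient gs) auto
  then have "(\<lambda>n. r n - norm (u - V n)) \<longlonglongrightarrow> r0 - norm (u - v)"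
    by (intro tendsto_intros r)
  then have lt: "eventually (\<lambda>n. 0 < r n - norm (u - V n)) sequentially"
    by (rule order_tendstoD) (use r in simp)
  \<comment> \<open>An index in \<open>B\<close> is exactly active at \<open>z\<close>, so this
    difference tends to 0, which is above \<open>- e\<close>.\<close>
  have "eventually (\<lambda>n. - e < gs i (s n) - G (s n)) sequentially" if i: "i \<in> B" for i
  proof -
    have "isCont (gs i) z"
      using i B gs continuously_differentiable_gradient(1) has_derivative_continuous
      unfolding gderiv_def by blast
    then have "(\<lambda>n. gs i (s n) - G (s n)) \<longlonglongrightarrow> gs i z - G z"
      by (intro tendsto_intros isCont_tendsto_compose[OF _ s] G)
    then show ?thesis by (rule order_tendstoD) (use i B e in auto)
  qed
  then have "eventually (\<lambda>n. \<forall>i\<in>B. - e < gs i (s n) - G (s n)) sequentially"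
    using fin by (simp only: eventually_ball_finite_distrib) blast
  with lt show ?thesis
  proof eventually_elim
    case (elim n)
    have "i \<in> strict_active g gs p e (s n)" if "i \<in> B" for i
      using elim(2) that B by (fastforce simp: strict_active_def g)
    then have "V n \<in> strict_subdifferential g gs p e (s n)"
      unfolding V_def strict_subdifferential_def
      by (intro convex_sum[OF fin convex_convex_hull w(2)] w(1) hull_inc) auto
    then have "infdist u (strict_subdifferential g gs p e (s n)) \<le> dist u (V n)"
      by (rule infdist_le)
    then show ?case using elim(1) by (simp add: dist_norm)
  qed
qed

theorem theorem6p3:
  fixes g h :: "real ^ 'n \<Rightarrow> ereal"
    and gs :: "nat \<Rightarrow> real ^ 'n \<Rightarrow> real" and p :: nat
    and T :: "real ^ 'n \<Rightarrow> real ^ 'n \<Rightarrow> real \<Rightarrow> nat \<Rightarrow> real ^ 'n"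
    and \<sigma> lam \<theta> \<rho> \<gamma> :: real and \<zeta> :: "nat \<Rightarrow> real"
    and x :: "int \<Rightarrow> real ^ 'n" and u :: "nat \<Rightarrow> real ^ 'n" and k :: nat
  assumes g: "g \<in> Gamma0" and h: "h \<in> Gamma0"
    and f_bdd: "(INF y. g y - h y) > -\<infinity>"
    and dom_h: "effective_domain h = UNIV"
    and p: "p \<ge> 1"
    and gs: "\<And>i. i \<in> {1..p} \<Longrightarrow> continuously_differentiable (gs i) \<and> convex_on UNIV (gs i)"
    and g_max: "\<And>y. g y = ereal (Max ((\<lambda>i. gs i y) ` {1..p}))"
    and T: "inner_algorithm g T"
    and \<sigma>: "0 < \<sigma>" "\<sigma> < 1"
    and lam: "lam > 0"
    and \<theta>: "\<theta> > 1 / lam"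
    and \<rho>: "0 \<le> \<rho>" "\<rho> < (1 - \<sigma>) / lam"
    and \<gamma>: "0 \<le> \<gamma>" "\<gamma> < (1 - \<sigma>) / lam - \<rho>"
    and \<zeta>: "\<And>j. \<zeta> j > 0" "\<zeta> \<longlonglongrightarrow> 0"
    and run: "tPLDCA_run g h gs p T \<sigma> lam \<theta> \<rho> \<gamma> \<zeta> x u k"
    and step1: "tPLDCA_step1 h \<rho> \<gamma> (x (int k - 1)) (x (int k)) (u k)"
  shows "\<exists>N::int. N \<ge> -1 \<and>
           (let z = inner_iterate T (x (int k)) (u k) lam N in
              g (x (int k)) - g z - ereal (u k \<bullet> (x (int k) - z))
                \<ge> ereal ((1 - \<sigma>) / lam * (norm (z - x (int k)))\<^sup>2) \<and>
              infdist (u k) (strict_subdifferential g gs p (\<zeta> k) z)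
                \<le> \<theta> * norm (z - x (int k)))"
proof -
  define G where "G y = Max ((\<lambda>i. gs i y) ` {1..p})" for y
  define X U where "X = x (int k)" and "U = u k"
  have I: "finite {1..p}" "{1..p} \<noteq> {}" using p by auto
  have gG: "g y = ereal (G y)" for y by (simp add: g_max G_def)
  have Gconv: "convex_on UNIV G"
    unfolding G_def using I gs by (intro convex_on_Max) auto
  have Gcont: "isCont G y" for y
    using convex_on_continuous[OF open_UNIV Gconv] by (simp add: continuous_on_eq_continuous_at)
  have "X \<in> effective_domain g" by (simp add: effective_domain_def gG)
  then obtain z where z: "is_arg_min (prox_objective g X U lam) (\<lambda>z. True) z"
    and lim: "T X U lam \<longlonglongrightarrow> z"
    using T lam unfolding inner_algorithm_def by blast
  have min: "G z - U \<bullet> (z - X) + 1 / (2 * lam) * (norm (z - X))\<^sup>2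
      \<le> G y - U \<bullet> (y - X) + 1 / (2 * lam) * (norm (y - X))\<^sup>2" for y
    using z unfolding is_arg_min_linorder prox_objective_def gG by simp
  define v where "v = U - (1 / lam) *\<^sub>R (z - X)"
  have v: "v \<in> convex hull ((\<lambda>i. gradient (gs i) z) ` {i \<in> {1..p}. gs i z = G z})"
    unfolding v_def using gs
    by (intro prox_gradient_in_convex_hull[OF I _ _ min] continuously_differentiable_gradient G_def) auto
  show ?thesis
  proof (cases "z = X")
    case True
    \<comment> \<open>Here \<open>v\<close> equals \<open>U\<close>, and exactly active indices are
      also \<open>\<zeta> k\<close>-active. At index -1 both tests then read 0 against 0.\<close>
    have "(\<lambda>i. gradient (gs i) z) ` {i \<in> {1..p}. gs i z = G z}
        \<subseteq> (\<lambda>i. gradient (gs i) z) ` strict_active g gs p (\<zeta> k) z"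
      using \<zeta>(1)[of k] by (auto simp: strict_active_def gG)
    from subsetD[OF hull_mono[OF this] v]
    have "U \<in> strict_subdifferential g gs p (\<zeta> k) X"
      using True by (simp add: strict_subdifferential_def v_def)
    then show ?thesis
      by (intro exI[of _ "-1"])
        (simp add: inner_iterate_def gG X_def[symmetric] U_def[symmetric])
  next
    case False
    then have pos: "norm (z - X) > 0" by simp
    let ?F = "\<lambda>y. G X - G y - U \<bullet> (X - y) - (1 - \<sigma>) / lam * (norm (y - X))\<^sup>2"
    \<comment> \<open>The factor \<open>1 - \<sigma> / 2\<close> is what \<open>prox_descent\<close>
      gives for t = \<open>\<sigma>\<close>. It exceeds \<open>1 - \<sigma>\<close>, which leaves
      the slack needed to pass from the limit to nearby iterates.\<close>
    have "(1 - \<sigma>) / lam * (norm (z - X))\<^sup>2 < (1 - \<sigma> / 2) / lam * (norm (z - X))\<^sup>2"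
      using pos lam \<sigma> by (intro mult_strict_right_mono divide_strict_right_mono) auto
    also have "\<dots> \<le> G X - G z - U \<bullet> (X - z)"
      using \<sigma> by (intro prox_descent[OF Gconv _ _ min]) auto
    finally have Fz: "0 < ?F z" by simp
    have "(\<lambda>n. ?F (T X U lam n)) \<longlonglongrightarrow> ?F z"
      by (intro tendsto_intros lim isCont_tendsto_compose[OF Gcont lim])
    then have ev1: "eventually (\<lambda>n. 0 < ?F (T X U lam n)) sequentially"
      using Fz by (rule order_tendstoD)
    \<comment> \<open>The left-hand side is \<open>norm (z - X) / lam\<close>, so strictness comes
      from \<open>\<theta> > 1 / lam\<close> and \<open>z \<noteq> X\<close>.\<close>
    have "norm (U - v) < \<theta> * norm (z - X)"
      using mult_strict_right_mono[OF \<theta> pos] lam by (simp add: v_def)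
    moreover have "(\<lambda>n. \<theta> * norm (T X U lam n - X)) \<longlonglongrightarrow> \<theta> * norm (z - X)"
      by (intro tendsto_intros lim)
    ultimately have ev2: "eventually (\<lambda>n. infdist U (strict_subdifferential g gs p (\<zeta> k) (T X U lam n))
        < \<theta> * norm (T X U lam n - X)) sequentially"
      using gs by (intro eventually_infdist_strict_subdifferential_less[OF _ gG Gcont \<zeta>(1) lim v]) auto
    obtain n where n: "0 < ?F (T X U lam n)" "infdist U (strict_subdifferential g gs p (\<zeta> k) (T X U lam n))
        < \<theta> * norm (T X U lam n - X)"
      using eventually_happens'[OF sequentially_bot eventually_conj[OF ev1 ev2]] by blast
    then show ?thesis
      by (intro exI[of _ "int n"])
        (simp add: inner_iterate_def gG Let_def X_def[symmetric] U_def[symmetric])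
  qed
qed

end
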